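(* Let $\mathbb{R}=(R,r)$ be an epireflector on a category $\mathbf{C}$, and let $\mathbb{T}=(T,\mu,\eta)$ and $\mathbb{M}=(M,n,e)$ be monads on $\mathbf{C}$. Assume that $T$ preserves epimorphisms, that $\mathbb{R}\circ\mathbb{T}$ is a monad (i.e. the composite monad exists), and that $MX\in R(\mathbf{C})$ for each object $X\in\mathbf{C}$. Then for any morphism of monads $\gamma:\mathbb{T}\to\mathbb{M}$, there is a unique morphism of monads $\lambda:\mathbb{R}\circ\mathbb{T}\to\mathbb{M}$ such that $\lambda\cdot rT=\gamma$.
   Context: A reflective subcategory of $\mathbf{C}$ is a full subcategory whose inclusion into $\mathbf{C}$ has a left adjoint $R$; with unit $r:1\to R$, the pair $\mathbb{R}=(R,r)$ is called a reflector, the reflective subcategory is denoted $R(\mathbf{C})$, and $R$ is regarded as an endofunctor of $\mathbf{C}$ (an idempotent monad with unit $r$ and multiplication $(r_R)^{-1}:RR\to R$). $(R,r)$ is an epireflector if each $r_X$ is an epimorphism in $\mathbf{C}$. For a monad $\mathbb{T}=(T,\mu,\eta)$, a $\mathbb{T}$-algebra is a pair $(X,a)$ with $a:TX\to X$ satisfying $a\cdot Ta=a\cdot\mu_X$ and $a\cdot\eta_X=1_X$; a homomorphism $f:(X,a)\to(Y,b)$ is a morphism $f:X\to Y$ with $f\cdot a=b\cdot Tf$. $\mathbf{C}^{\mathbb{T}}$ is the category of $\mathbb{T}$-algebras and $G^{\mathbb{T}}:\mathbf{C}^{\mathbb{T}}\to\mathbf{C}$ the forgetful functor. A morphism of monads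 $(T,\mu,\eta)\to(M,n,e)$ is a natural transformation $\alpha:T\to M$ with $\alpha\cdot\eta=e$ and $\alpha\cdot\mu=n\cdot(\alpha\circ\alpha)$, where $\alpha\circ\alpha=\alpha M\cdot T\alpha:TT\to MM$ is horizontal composition. Composite monad: "$\mathbb{R}\circ\mathbb{T}$ is a monad" means that $R$ lifts to $\mathbf{C}^{\mathbb{T}}$, i.e. there is a monad $\tilde{\mathbb{R}}=(\tilde{R},\tilde{n},d)$ on $\mathbf{C}^{\mathbb{T}}$ with $G^{\mathbb{T}}\tilde{R}=RG^{\mathbb{T}}$, whose unit $d$ and multiplication $\tilde{n}$ have as underlying natural transformations the unit $rG^{\mathbb{T}}$ and multiplication of $R$. Then $\mathbb{R}\circ\mathbb{T}=(RT,w,r\circ\eta)$, where $(r\circ\eta)_X=r_{TX}\cdot\eta_X$ and, writing $\tilde{R}(TX,\mu_X)=(RTX,\tilde{\mu}_X)$ with $\tilde{\mu}_X:TRTX\to RTX$, $w_X:RTRTX\to RTX$ is the unique morphism with $w_X\cdot r_{TRTX}=\tilde{\mu}_X$. *)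

theory Defs
  imports "HOL-Library.FuncSet"
begin

section \<open>Categories, functors, natural transformations\<close>

record ('o, 'a) cat =
  Obj :: "'o set"
  Arr :: "'a set"
  Dom :: "'a \<Rightarrow> 'o"
  Cod :: "'a \<Rightarrow> 'o"
  Id :: "'o \<Rightarrow> 'a"
  Comp :: "'a \<Rightarrow> 'a \<Rightarrow> 'a" (infixr "\<cdot>\<index>" 70)

definition Hom :: "('o, 'a) cat \<Rightarrow> 'o \<Rightarrow> 'o \<Rightarrow> 'a set" where
  "Hom C X Y = {f \<in> Arr C. Dom C f = X \<and> Cod C f = Y}"

locale category =
  fixes C :: "('o, 'a) cat" (structure)
  assumes Dom_in: "f \<in> Arr C \<Longrightarrow> Dom C f \<in> Obj C"
    and Cod_in: "f \<in> Arr C \<Longrightarrow> Cod C f \<in> Obj C"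
    and Id_in: "X \<in> Obj C \<Longrightarrow> Id C X \<in> Hom C X X"
    and Comp_in: "\<lbrakk>f \<in> Hom C X Y; g \<in> Hom C Y Z\<rbrakk> \<Longrightarrow> g \<cdot> f \<in> Hom C X Z"
    and Comp_Id: "f \<in> Hom C X Y \<Longrightarrow> f \<cdot> Id C X = f"
    and Id_Comp: "f \<in> Hom C X Y \<Longrightarrow> Id C Y \<cdot> f = f"
    and Comp_assoc: "\<lbrakk>f \<in> Hom C W X; g \<in> Hom C X Y; h \<in> Hom C Y Z\<rbrakk>
      \<Longrightarrow> h \<cdot> (g \<cdot> f) = (h \<cdot> g) \<cdot> f"

text \<open>
  Functors and natural transformations are required to be extensional outside the
  objects and arrows of their source, and all operations on them restrict
  accordingly. Hence HOL equality is the mathematical equality of functors and of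
  natural transformations, and \<open>\<exists>!\<close> expresses genuine uniqueness.
\<close>

record ('o, 'a, 'p, 'b) func =
  onObj :: "'o \<Rightarrow> 'p"
  onArr :: "'a \<Rightarrow> 'b"

locale is_functor = A: category A + B: category B
  for A :: "('o, 'a) cat" and B :: "('p, 'b) cat" +
  fixes F :: "('o, 'a, 'p, 'b) func"
  assumes onObj_in: "X \<in> Obj A \<Longrightarrow> onObj F X \<in> Obj B"
    and onArr_in: "f \<in> Hom A X Y \<Longrightarrow> onArr F f \<in> Hom B (onObj F X) (onObj F Y)"
    and onArr_Id: "X \<in> Obj A \<Longrightarrow> onArr F (Id A X) = Id B (onObj F X)"
    and onArr_Comp: "\<lbrakk>f \<in> Hom A X Y; g \<in> Hom A Y Z\<rbrakk>
      \<Longrightarrow> onArr F (g \<cdot>\<^bsub>A\<^esub> f) = onArr F g \<cdot>\<^bsub>B\<^esub> onArr F f"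
    and onObj_ext: "onObj F \<in> extensional (Obj A)"
    and onArr_ext: "onArr F \<in> extensional (Arr A)"

definition id_functor :: "('o, 'a) cat \<Rightarrow> ('o, 'a, 'o, 'a) func" where
  "id_functor A = \<lparr>onObj = (\<lambda>X\<in>Obj A. X), onArr = (\<lambda>f\<in>Arr A. f)\<rparr>"

definition comp_functor ::
  "('o, 'a) cat \<Rightarrow> ('p, 'b, 'q, 'c) func \<Rightarrow> ('o, 'a, 'p, 'b) func \<Rightarrow> ('o, 'a, 'q, 'c) func" where
  "comp_functor A G F =
    \<lparr>onObj = compose (Obj A) (onObj G) (onObj F), onArr = compose (Arr A) (onArr G) (onArr F)\<rparr>"

locale nat_trans = F: is_functor A B F + G: is_functor A B G
  for A :: "('o, 'a) cat" and B :: "('p, 'b) cat"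
    and F :: "('o, 'a, 'p, 'b) func" and G :: "('o, 'a, 'p, 'b) func" +
  fixes \<tau> :: "'o \<Rightarrow> 'b"
  assumes component_in: "X \<in> Obj A \<Longrightarrow> \<tau> X \<in> Hom B (onObj F X) (onObj G X)"
    and naturality: "f \<in> Hom A X Y \<Longrightarrow> onArr G f \<cdot>\<^bsub>B\<^esub> \<tau> X = \<tau> Y \<cdot>\<^bsub>B\<^esub> onArr F f"
    and component_ext: "\<tau> \<in> extensional (Obj A)"

definition id_trans :: "('o, 'a) cat \<Rightarrow> ('p, 'b) cat \<Rightarrow> ('o, 'a, 'p, 'b) func \<Rightarrow> 'o \<Rightarrow> 'b" where
  "id_trans A B F = (\<lambda>X\<in>Obj A. Id B (onObj F X))"

definition vcomp ::
  "('o, 'a) cat \<Rightarrow> ('p, 'b) cat \<Rightarrow> ('o \<Rightarrow> 'b) \<Rightarrow> ('o \<Rightarrow> 'b) \<Rightarrow> 'o \<Rightarrow> 'b" where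
  "vcomp A B \<beta> \<alpha> = (\<lambda>X\<in>Obj A. \<beta> X \<cdot>\<^bsub>B\<^esub> \<alpha> X)"

text \<open>\<open>whiskerR A \<alpha> F\<close> is the transformation \<open>\<alpha>F\<close>; \<open>whiskerL A F \<alpha>\<close> is \<open>F\<alpha>\<close>.\<close>

definition whiskerR ::
  "('o, 'a) cat \<Rightarrow> ('p \<Rightarrow> 'c) \<Rightarrow> ('o, 'a, 'p, 'b) func \<Rightarrow> 'o \<Rightarrow> 'c" where
  "whiskerR A \<alpha> F = (\<lambda>X\<in>Obj A. \<alpha> (onObj F X))"

definition whiskerL ::
  "('o, 'a) cat \<Rightarrow> ('p, 'b, 'q, 'c) func \<Rightarrow> ('o \<Rightarrow> 'b) \<Rightarrow> 'o \<Rightarrow> 'c" where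
  "whiskerL A F \<alpha> = (\<lambda>X\<in>Obj A. onArr F (\<alpha> X))"

text \<open>For \<open>\<alpha> : F \<rightarrow> G\<close> between functors \<open>A \<rightarrow> B\<close> and \<open>\<beta> : H \<rightarrow> K\<close> between functors
  \<open>B \<rightarrow> D\<close>, the horizontal composite is \<open>\<beta>G \<cdot> H\<alpha> : HF \<rightarrow> KG\<close>.\<close>

definition hcomp ::
  "('o, 'a) cat \<Rightarrow> ('q, 'c) cat \<Rightarrow> ('p, 'b, 'q, 'c) func \<Rightarrow> ('o, 'a, 'p, 'b) func
    \<Rightarrow> ('p \<Rightarrow> 'c) \<Rightarrow> ('o \<Rightarrow> 'b) \<Rightarrow> 'o \<Rightarrow> 'c" where
  "hcomp A D H G \<beta> \<alpha> = vcomp A D (whiskerR A \<beta> G) (whiskerL A H \<alpha>)"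

definition epi :: "('o, 'a) cat \<Rightarrow> 'a \<Rightarrow> bool" where
  "epi C f \<longleftrightarrow> f \<in> Arr C \<and>
    (\<forall>Z. \<forall>g \<in> Hom C (Cod C f) Z. \<forall>h \<in> Hom C (Cod C f) Z. g \<cdot>\<^bsub>C\<^esub> f = h \<cdot>\<^bsub>C\<^esub> f \<longrightarrow> g = h)"

definition preserves_epis ::
  "('o, 'a) cat \<Rightarrow> ('p, 'b) cat \<Rightarrow> ('o, 'a, 'p, 'b) func \<Rightarrow> bool" where
  "preserves_epis A B F \<longleftrightarrow> (\<forall>f. epi A f \<longrightarrow> epi B (onArr F f))"

definition inv_arr :: "('o, 'a) cat \<Rightarrow> 'a \<Rightarrow> 'a" where
  "inv_arr C f = (THE g. g \<in> Hom C (Cod C f) (Dom C f) \<and>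
    g \<cdot>\<^bsub>C\<^esub> f = Id C (Dom C f) \<and> f \<cdot>\<^bsub>C\<^esub> g = Id C (Cod C f))"


section \<open>Reflectors\<close>

text \<open>\<open>F\<close> is left adjoint to \<open>G\<close> with unit \<open>\<eta>\<close>. The hom-set bijection is automatically
  natural, being given by \<open>g \<mapsto> G g \<cdot> \<eta>\<^sub>X\<close>.\<close>

definition adjunction ::
  "('o, 'a) cat \<Rightarrow> ('p, 'b) cat \<Rightarrow> ('o, 'a, 'p, 'b) func \<Rightarrow> ('p, 'b, 'o, 'a) func
    \<Rightarrow> ('o \<Rightarrow> 'a) \<Rightarrow> bool" where
  "adjunction C D F G \<eta> \<longleftrightarrow>
    is_functor C D F \<and> is_functor D C G \<and>
    nat_trans C C (id_functor C) (comp_functor C G F) \<eta> \<and>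
    (\<forall>X \<in> Obj C. \<forall>Y \<in> Obj D.
      bij_betw (\<lambda>g. onArr G g \<cdot>\<^bsub>C\<^esub> \<eta> X) (Hom D (onObj F X) Y) (Hom C X (onObj G Y)))"

definition full_subcategory :: "('o, 'a) cat \<Rightarrow> 'o set \<Rightarrow> ('o, 'a) cat" where
  "full_subcategory C S = C\<lparr>Obj := S, Arr := {f \<in> Arr C. Dom C f \<in> S \<and> Cod C f \<in> S}\<rparr>"

text \<open>
  The inclusion of a full subcategory is \<open>id_functor (full_subcategory C S)\<close>. Since a
  full subcategory shares the types of \<open>C\<close>, the left adjoint \<open>R\<close> and the endofunctor of
  \<open>C\<close> it induces by composing with the inclusion are the same \<open>func\<close>. The subcategory is
  not required to be closed under isomorphism.
\<close>

definition reflector ::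
  "('o, 'a) cat \<Rightarrow> 'o set \<Rightarrow> ('o, 'a, 'o, 'a) func \<Rightarrow> ('o \<Rightarrow> 'a) \<Rightarrow> bool" where
  "reflector C S R r \<longleftrightarrow> S \<subseteq> Obj C \<and>
    adjunction C (full_subcategory C S) R (id_functor (full_subcategory C S)) r"

definition epireflector ::
  "('o, 'a) cat \<Rightarrow> 'o set \<Rightarrow> ('o, 'a, 'o, 'a) func \<Rightarrow> ('o \<Rightarrow> 'a) \<Rightarrow> bool" where
  "epireflector C S R r \<longleftrightarrow> reflector C S R r \<and> (\<forall>X \<in> Obj C. epi C (r X))"


section \<open>Monads and their algebras\<close>

record ('o, 'a) mnd =
  Endo :: "('o, 'a, 'o, 'a) func"
  Mult :: "'o \<Rightarrow> 'a"
  Unit :: "'o \<Rightarrow> 'a"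

definition monad :: "('o, 'a) cat \<Rightarrow> ('o, 'a) mnd \<Rightarrow> bool" where
  "monad C T \<longleftrightarrow>
    is_functor C C (Endo T) \<and>
    nat_trans C C (comp_functor C (Endo T) (Endo T)) (Endo T) (Mult T) \<and>
    nat_trans C C (id_functor C) (Endo T) (Unit T) \<and>
    vcomp C C (Mult T) (whiskerL C (Endo T) (Mult T))
      = vcomp C C (Mult T) (whiskerR C (Mult T) (Endo T)) \<and>
    vcomp C C (Mult T) (whiskerL C (Endo T) (Unit T)) = id_trans C C (Endo T) \<and>
    vcomp C C (Mult T) (whiskerR C (Unit T) (Endo T)) = id_trans C C (Endo T)"

definition monad_morphism ::
  "('o, 'a) cat \<Rightarrow> ('o, 'a) mnd \<Rightarrow> ('o, 'a) mnd \<Rightarrow> ('o \<Rightarrow> 'a) \<Rightarrow> bool" where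
  "monad_morphism C T M \<alpha> \<longleftrightarrow>
    monad C T \<and> monad C M \<and>
    nat_trans C C (Endo T) (Endo M) \<alpha> \<and>
    vcomp C C \<alpha> (Unit T) = Unit M \<and>
    vcomp C C \<alpha> (Mult T) = vcomp C C (Mult M) (hcomp C C (Endo T) (Endo M) \<alpha> \<alpha>)"

definition algebra :: "('o, 'a) cat \<Rightarrow> ('o, 'a) mnd \<Rightarrow> 'o \<times> 'a \<Rightarrow> bool" where
  "algebra C T = (\<lambda>(X, a).
    X \<in> Obj C \<and> a \<in> Hom C (onObj (Endo T) X) X \<and>
    a \<cdot>\<^bsub>C\<^esub> onArr (Endo T) a = a \<cdot>\<^bsub>C\<^esub> Mult T X \<and>
    a \<cdot>\<^bsub>C\<^esub> Unit T X = Id C X)"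

definition algebra_hom ::
  "('o, 'a) cat \<Rightarrow> ('o, 'a) mnd \<Rightarrow> 'o \<times> 'a \<Rightarrow> 'a \<Rightarrow> 'o \<times> 'a \<Rightarrow> bool" where
  "algebra_hom C T = (\<lambda>(X, a) f (Y, b).
    f \<in> Hom C X Y \<and> f \<cdot>\<^bsub>C\<^esub> a = b \<cdot>\<^bsub>C\<^esub> onArr (Endo T) f)"

text \<open>An arrow of the category of algebras carries its source and target algebra, because
  the same \<open>f\<close> may be a homomorphism for several algebra structures.\<close>

type_synonym ('o, 'a) alg_arr = "('o \<times> 'a) \<times> 'a \<times> ('o \<times> 'a)"

definition algebras ::
  "('o, 'a) cat \<Rightarrow> ('o, 'a) mnd \<Rightarrow> ('o \<times> 'a, ('o, 'a) alg_arr) cat" where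
  "algebras C T =
    \<lparr>Obj = {A. algebra C T A},
     Arr = {(A, f, B). algebra C T A \<and> algebra C T B \<and> algebra_hom C T A f B},
     Dom = (\<lambda>(A, f, B). A),
     Cod = (\<lambda>(A, f, B). B),
     Id = (\<lambda>A. (A, Id C (fst A), A)),
     Comp = (\<lambda>(B', g, D) (A, f, B). (A, g \<cdot>\<^bsub>C\<^esub> f, D))\<rparr>"

definition forgetful ::
  "('o, 'a) cat \<Rightarrow> ('o, 'a) mnd \<Rightarrow> ('o \<times> 'a, ('o, 'a) alg_arr, 'o, 'a) func" where
  "forgetful C T =
    \<lparr>onObj = (\<lambda>A\<in>Obj (algebras C T). fst A),
     onArr = (\<lambda>h\<in>Arr (algebras C T). fst (snd h))\<rparr>"

lemma category_algebras:
  assumes "monad C T"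
  shows "category (algebras C T)"
proof -
  interpret T: is_functor C C "Endo T"
    using assms by (simp add: monad_def)
  show ?thesis
  proof
    fix A assume "A \<in> Obj (algebras C T)"
    then obtain X a where A: "A = (X, a)" and X: "X \<in> Obj C"
      and a: "a \<in> Hom C (onObj (Endo T) X) X" and alg: "algebra C T A"
      by (cases A) (auto simp: algebras_def algebra_def)
    show "Id (algebras C T) A \<in> Hom (algebras C T) A A"
      using alg a X T.A.Id_in[OF X] T.onArr_Id[OF X] T.A.Comp_Id[OF a] T.A.Id_Comp[OF a]
      by (auto simp: algebras_def Hom_def algebra_hom_def A)
  next
    fix k h A B D assume "k \<in> Hom (algebras C T) A B" "h \<in> Hom (algebras C T) B D"
    then obtain X a Y b Z d f g where e: "A = (X, a)" "B = (Y, b)" "D = (Z, d)"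
        "k = (A, f, B)" "h = (B, g, D)"
      and alg: "algebra C T A" "algebra C T B" "algebra C T D"
      and hom: "algebra_hom C T A f B" "algebra_hom C T B g D"
      by (cases A; cases B; cases D) (auto simp: algebras_def Hom_def)
    have f: "f \<in> Hom C X Y" and g: "g \<in> Hom C Y Z"
      and fa: "f \<cdot>\<^bsub>C\<^esub> a = b \<cdot>\<^bsub>C\<^esub> onArr (Endo T) f"
      and gb: "g \<cdot>\<^bsub>C\<^esub> b = d \<cdot>\<^bsub>C\<^esub> onArr (Endo T) g"
      using hom by (simp_all add: e algebra_hom_def)
    have a: "a \<in> Hom C (onObj (Endo T) X) X" and b: "b \<in> Hom C (onObj (Endo T) Y) Y"
      and d: "d \<in> Hom C (onObj (Endo T) Z) Z"
      using alg by (simp_all add: e algebra_def)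
    note Tf = T.onArr_in[OF f] and Tg = T.onArr_in[OF g]
    have "(g \<cdot>\<^bsub>C\<^esub> f) \<cdot>\<^bsub>C\<^esub> a = d \<cdot>\<^bsub>C\<^esub> onArr (Endo T) (g \<cdot>\<^bsub>C\<^esub> f)"
      using T.A.Comp_assoc[OF a f g] T.A.Comp_assoc[OF Tf b g] T.A.Comp_assoc[OF Tf Tg d]
      by (simp add: T.onArr_Comp[OF f g] fa gb)
    then show "h \<cdot>\<^bsub>algebras C T\<^esub> k \<in> Hom (algebras C T) A D"
      using alg T.A.Comp_in[OF f g]
      by (simp add: e algebras_def Hom_def algebra_hom_def)
  qed (auto simp: algebras_def Hom_def algebra_hom_def
      intro: T.A.Comp_Id T.A.Id_Comp T.A.Comp_assoc[unfolded Hom_def, simplified])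
qed


section \<open>Liftings and the composite monad\<close>

definition reflector_monad ::
  "('o, 'a) cat \<Rightarrow> ('o, 'a, 'o, 'a) func \<Rightarrow> ('o \<Rightarrow> 'a) \<Rightarrow> ('o, 'a) mnd" where
  "reflector_monad C R r =
    \<lparr>Endo = R, Mult = (\<lambda>X\<in>Obj C. inv_arr C (r (onObj R X))), Unit = r\<rparr>"

definition lifting ::
  "('o, 'a) cat \<Rightarrow> ('o, 'a) mnd \<Rightarrow> ('o, 'a) mnd \<Rightarrow> ('o \<times> 'a, ('o, 'a) alg_arr) mnd \<Rightarrow> bool" where
  "lifting C T P L \<longleftrightarrow>
    monad (algebras C T) L \<and>
    comp_functor (algebras C T) (forgetful C T) (Endo L)
      = comp_functor (algebras C T) (Endo P) (forgetful C T) \<and>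
    whiskerL (algebras C T) (forgetful C T) (Unit L)
      = whiskerR (algebras C T) (Unit P) (forgetful C T) \<and>
    whiskerL (algebras C T) (forgetful C T) (Mult L)
      = whiskerR (algebras C T) (Mult P) (forgetful C T)"

definition lifted_structure ::
  "('o, 'a) mnd \<Rightarrow> ('o \<times> 'a, ('o, 'a) alg_arr) mnd \<Rightarrow> 'o \<Rightarrow> 'a" where
  "lifted_structure T L X = snd (onObj (Endo L) (onObj (Endo T) X, Mult T X))"

text \<open>The composite of \<open>T\<close> with the reflector \<open>(R, r)\<close> determined by a lifting \<open>L\<close> of \<open>R\<close> to
  the \<open>T\<close>-algebras.\<close>

definition composite_monad ::
  "('o, 'a) cat \<Rightarrow> ('o, 'a, 'o, 'a) func \<Rightarrow> ('o \<Rightarrow> 'a) \<Rightarrow> ('o, 'a) mnd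
    \<Rightarrow> ('o \<times> 'a, ('o, 'a) alg_arr) mnd \<Rightarrow> ('o, 'a) mnd" where
  "composite_monad C R r T L =
    (let RT = comp_functor C R (Endo T) in
     \<lparr>Endo = RT,
      Mult = (\<lambda>X\<in>Obj C. THE w.
        w \<in> Hom C (onObj RT (onObj RT X)) (onObj RT X) \<and>
        w \<cdot>\<^bsub>C\<^esub> r (onObj (Endo T) (onObj RT X)) = lifted_structure T L X),
      Unit = vcomp C C (whiskerR C r (Endo T)) (Unit T)\<rparr>)"

end

theory Submission
  imports Defs
begin

text \<open>
  Write \<open>m\<^sub>X : T R T X \<rightarrow> R T X\<close> for the structure that the lifting of \<open>R\<close> puts on the
  reflection of the free algebra \<open>(T X, \<mu>\<^sub>X)\<close>. The unit of the lifting is a homomorphism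
  of algebras with underlying arrow \<open>r\<close>, so \<open>m\<^sub>X \<cdot> T r = r \<cdot> \<mu>\<^sub>X\<close>, and the
  multiplication \<open>w\<close> of the composite monad satisfies \<open>w\<^sub>X \<cdot> r = m\<^sub>X\<close>. Since \<open>r\<close> is an
  epimorphism and \<open>T\<close> preserves epimorphisms, both \<open>r\<close> and \<open>T r\<close> can be cancelled on the
  right. These two equations reduce each law about \<open>w\<close> to a law about \<open>m\<close>, and from there
  to a law of the monad \<open>T\<close> or of the algebra \<open>m\<close>. In this way the composite is
  seen to be a monad (\<open>monad_composite\<close>), and the same cancellations give the theorem.

  As \<open>M X\<close> lies in the reflective subcategory, \<open>\<gamma>\<^sub>X : T X \<rightarrow> M X\<close> extends uniquely along
  \<open>r : T X \<rightarrow> R T X\<close>; the extension is the only candidate for \<open>\<lambda>\<^sub>X\<close>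
  (\<open>extend_unique\<close>). Precomposing with \<open>r\<close> turns naturality and the unit law for
  \<open>\<lambda>\<close> into those for \<open>\<gamma>\<close>. For compatibility with multiplication (\<open>extend_mult\<close>) one
  precomposes first with \<open>r\<close> and then with \<open>T r\<close>; the two sides
  \<open>\<lambda> \<cdot> w\<close> and \<open>n \<cdot> \<lambda>M \<cdot> RT\<lambda>\<close> become \<open>\<gamma> \<cdot> \<mu>\<close> and \<open>n \<cdot> \<gamma>M \<cdot> T\<gamma>\<close>.
\<close>


section \<open>Equational reasoning with arrows\<close>

text \<open>Typing facts are restated with \<open>Arr\<close>, \<open>Dom\<close> and \<open>Cod\<close> in place of hom-sets: the
  simplifier can then check that a composite is defined without guessing the objects
  in between.\<close>

context category
begin

lemma arrow_objects [simp]: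
  "f \<in> Arr C \<Longrightarrow> Dom C f \<in> Obj C"
  "f \<in> Arr C \<Longrightarrow> Cod C f \<in> Obj C"
  by (simp_all add: Dom_in Cod_in)

lemma Id_arrow [simp]:
  assumes "X \<in> Obj C"
  shows "Id C X \<in> Arr C" "Dom C (Id C X) = X" "Cod C (Id C X) = X"
  using Id_in[OF assms] by (simp_all add: Hom_def)

lemma Comp_arrow [simp]:
  assumes "f \<in> Arr C" "g \<in> Arr C" "Dom C g = Cod C f"
  shows "g \<cdot> f \<in> Arr C" "Dom C (g \<cdot> f) = Dom C f" "Cod C (g \<cdot> f) = Cod C g"
  using Comp_in[of f "Dom C f" "Cod C f" g "Cod C g"] assms by (simp_all add: Hom_def)

lemma Comp_Id_arrow [simp]:
  "\<lbrakk>f \<in> Arr C; Dom C f = X\<rbrakk> \<Longrightarrow> f \<cdot> Id C X = f"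
  "\<lbrakk>f \<in> Arr C; Cod C f = X\<rbrakk> \<Longrightarrow> Id C X \<cdot> f = f"
  by (auto simp: Hom_def intro: Comp_Id Id_Comp)

lemma assoc_right:
  "\<lbrakk>f \<in> Arr C; g \<in> Arr C; h \<in> Arr C; Dom C g = Cod C f; Dom C h = Cod C g\<rbrakk>
    \<Longrightarrow> (h \<cdot> g) \<cdot> f = h \<cdot> g \<cdot> f"
  by (rule Comp_assoc[symmetric]) (auto simp: Hom_def)

text \<open>Composites are kept bracketed to the right, where an equation \<open>g \<cdot> f = k\<close> no longer
  matches once a further arrow follows; this is the form that still does.\<close>

lemma precomposed:
  "\<lbrakk>g \<cdot> f = k; f \<in> Arr C; g \<in> Arr C; Dom C g = Cod C f; h \<in> Arr C; Dom C f = Cod C h\<rbrakk>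
    \<Longrightarrow> g \<cdot> f \<cdot> h = k \<cdot> h"
  using assoc_right[of h f g] by simp

lemma epi_cancel:
  assumes "epi C f" "g \<cdot> f = h \<cdot> f" "g \<in> Arr C" "h \<in> Arr C"
    "Dom C g = Cod C f" "Dom C h = Cod C f" "Cod C g = Cod C h"
  shows "g = h"
  using assms by (auto simp: epi_def Hom_def)

end

context is_functor
begin

lemma onObj_Obj [simp]: "X \<in> Obj A \<Longrightarrow> onObj F X \<in> Obj B"
  by (rule onObj_in)

lemma onArr_arrow [simp]:
  assumes "f \<in> Arr A"
  shows "onArr F f \<in> Arr B" "Dom B (onArr F f) = onObj F (Dom A f)"
    "Cod B (onArr F f) = onObj F (Cod A f)"
  using onArr_in[of f "Dom A f" "Cod A f"] assms by (simp_all add: Hom_def)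

lemma onArr_Comp_arrow:
  "\<lbrakk>f \<in> Arr A; g \<in> Arr A; Dom A g = Cod A f\<rbrakk>
    \<Longrightarrow> onArr F (g \<cdot>\<^bsub>A\<^esub> f) = onArr F g \<cdot>\<^bsub>B\<^esub> onArr F f"
  by (rule onArr_Comp) (auto simp: Hom_def)

end

context nat_trans
begin

lemma component_arrow [simp]:
  assumes "X \<in> Obj A"
  shows "\<tau> X \<in> Arr B" "Dom B (\<tau> X) = onObj F X" "Cod B (\<tau> X) = onObj G X"
  using component_in[OF assms] by (simp_all add: Hom_def)

lemma naturality_arrow:
  "\<lbrakk>f \<in> Arr A; Dom A f = X\<rbrakk> \<Longrightarrow> onArr G f \<cdot>\<^bsub>B\<^esub> \<tau> X = \<tau> (Cod A f) \<cdot>\<^bsub>B\<^esub> onArr F f"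
  by (rule naturality) (auto simp: Hom_def)

end

lemma comp_functor_apply [simp]:
  "X \<in> Obj A \<Longrightarrow> onObj (comp_functor A G F) X = onObj G (onObj F X)"
  "f \<in> Arr A \<Longrightarrow> onArr (comp_functor A G F) f = onArr G (onArr F f)"
  by (simp_all add: comp_functor_def compose_def)

lemma id_functor_apply [simp]:
  "X \<in> Obj A \<Longrightarrow> onObj (id_functor A) X = X"
  "f \<in> Arr A \<Longrightarrow> onArr (id_functor A) f = f"
  by (simp_all add: id_functor_def)

lemma is_functor_comp_functor:
  assumes "is_functor A B F" "is_functor B D G"
  shows "is_functor A D (comp_functor A G F)"
proof -
  interpret F: is_functor A B F by fact
  interpret G: is_functor B D G by fact
  show ?thesis
    by unfold_locales
      (auto simp: Hom_def F.onArr_Id G.onArr_Id F.onArr_Comp_arrow G.onArr_Comp_arrow,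
       auto simp: comp_functor_def compose_def)
qed

lemma is_functor_id_functor:
  assumes "category A"
  shows "is_functor A A (id_functor A)"
proof -
  interpret category A by fact
  show ?thesis
    by unfold_locales (auto simp: Hom_def, auto simp: id_functor_def)
qed


section \<open>Monads at an object\<close>

locale monad_on =
  fixes C :: "('o, 'a) cat" (structure) and T :: "('o, 'a) mnd"
  assumes monad: "monad C T"
begin

sublocale is_functor C C "Endo T"
  using monad by (simp add: monad_def)

sublocale mult: nat_trans C C "comp_functor C (Endo T) (Endo T)" "Endo T" "Mult T"
  using monad by (simp add: monad_def)

sublocale unit: nat_trans C C "id_functor C" "Endo T" "Unit T"
  using monad by (simp add: monad_def)

lemma Unit_natural:
  assumes "f \<in> Arr C" "Dom C f = X"
  shows "onArr (Endo T) f \<cdot> Unit T X = Unit T (Cod C f) \<cdot> f"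
  using unit.naturality_arrow[OF assms] assms by simp

lemma Mult_natural:
  assumes "f \<in> Arr C" "Dom C f = X"
  shows "onArr (Endo T) f \<cdot> Mult T X = Mult T (Cod C f) \<cdot> onArr (Endo T) (onArr (Endo T) f)"
  using mult.naturality_arrow[OF assms] assms by simp

lemma
  assumes "X \<in> Obj C"
  shows Mult_assoc: "Mult T X \<cdot> onArr (Endo T) (Mult T X) = Mult T X \<cdot> Mult T (onObj (Endo T) X)"
    and Mult_Unit_left: "Mult T X \<cdot> onArr (Endo T) (Unit T X) = Id C (onObj (Endo T) X)"
    and Mult_Unit_right: "Mult T X \<cdot> Unit T (onObj (Endo T) X) = Id C (onObj (Endo T) X)"
proof -
  have *: "vcomp C C (Mult T) (whiskerL C (Endo T) (Mult T)) X
      = vcomp C C (Mult T) (whiskerR C (Mult T) (Endo T)) X"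
    "vcomp C C (Mult T) (whiskerL C (Endo T) (Unit T)) X = id_trans C C (Endo T) X"
    "vcomp C C (Mult T) (whiskerR C (Unit T) (Endo T)) X = id_trans C C (Endo T) X"
    using monad by (simp_all add: monad_def)
  then show "Mult T X \<cdot> onArr (Endo T) (Mult T X) = Mult T X \<cdot> Mult T (onObj (Endo T) X)"
    "Mult T X \<cdot> onArr (Endo T) (Unit T X) = Id C (onObj (Endo T) X)"
    "Mult T X \<cdot> Unit T (onObj (Endo T) X) = Id C (onObj (Endo T) X)"
    using assms by (simp_all add: vcomp_def whiskerL_def whiskerR_def id_trans_def)
qed

lemma algebra_free: "X \<in> Obj C \<Longrightarrow> algebra C T (onObj (Endo T) X, Mult T X)"
  by (simp add: algebra_def Hom_def Mult_assoc Mult_Unit_right)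

end


section \<open>Epireflectors\<close>

locale epireflection = category C
  for C :: "('o, 'a) cat" (structure) +
  fixes S :: "'o set" and R :: "('o, 'a, 'o, 'a) func" and r :: "'o \<Rightarrow> 'a"
  assumes epireflector: "epireflector C S R r"
begin

lemma full_subcategory_simps [simp]:
  "Obj (full_subcategory C S) = S"
  "f \<in> Arr (full_subcategory C S) \<longleftrightarrow> f \<in> Arr C \<and> Dom C f \<in> S \<and> Cod C f \<in> S"
  "Dom (full_subcategory C S) = Dom C"
  "Cod (full_subcategory C S) = Cod C"
  "Id (full_subcategory C S) = Id C"
  "Comp (full_subcategory C S) = Comp C"
  by (auto simp: full_subcategory_def)

lemma
  shows functor_to_subcategory: "is_functor C (full_subcategory C S) R"
    and unit_natural: "nat_trans C C (id_functor C)
      (comp_functor C (id_functor (full_subcategory C S)) R) r"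
    and unit_universal: "\<lbrakk>X \<in> Obj C; Y \<in> S\<rbrakk> \<Longrightarrow>
      bij_betw (\<lambda>g. onArr (id_functor (full_subcategory C S)) g \<cdot> r X)
        (Hom (full_subcategory C S) (onObj R X) Y)
        (Hom C X (onObj (id_functor (full_subcategory C S)) Y))"
    and S_subset: "S \<subseteq> Obj C"
    and epi_r: "X \<in> Obj C \<Longrightarrow> epi C (r X)"
  using epireflector
  by (auto simp: epireflector_def reflector_def adjunction_def)

lemma R_in_S [simp]: "X \<in> Obj C \<Longrightarrow> onObj R X \<in> S"
  using is_functor.onObj_in[OF functor_to_subcategory] by simp

text \<open>The left adjoint into the subcategory doubles as an endofunctor of \<open>C\<close>.\<close>

sublocale R: is_functor C C R
proof -
  interpret RS: is_functor C "full_subcategory C S" R by (rule functor_to_subcategory)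
  show "is_functor C C R"
  proof
    show "onObj R X \<in> Obj C" if "X \<in> Obj C" for X
      using R_in_S[OF that] S_subset by blast
    show "onArr R f \<in> Hom C (onObj R X) (onObj R Y)" if "f \<in> Hom C X Y" for f X Y
      using RS.onArr_in[OF that] by (simp add: Hom_def)
  qed (use RS.onArr_Id RS.onArr_Comp RS.onObj_ext RS.onArr_ext in auto)
qed

lemma r_arrow [simp]:
  assumes "X \<in> Obj C"
  shows "r X \<in> Arr C" "Dom C (r X) = X" "Cod C (r X) = onObj R X"
  using nat_trans.component_in[OF unit_natural assms] assms by (simp_all add: Hom_def)

lemma R_r:
  assumes "f \<in> Arr C" "Dom C f = X"
  shows "onArr R f \<cdot> r X = r (Cod C f) \<cdot> f"
  using nat_trans.naturality[OF unit_natural, of f X "Cod C f"] assms by (auto simp: Hom_def)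

lemma cancel_r:
  assumes "g \<cdot> r X = h \<cdot> r X" "X \<in> Obj C" "g \<in> Arr C" "h \<in> Arr C"
    "Dom C g = onObj R X" "Dom C h = onObj R X" "Cod C g = Cod C h"
  shows "g = h"
  by (rule epi_cancel[OF epi_r[of X]]) (use assms in simp_all)

text \<open>The adjunction gives an extension inside the full subcategory, and it is unique
  because \<open>r\<close> is an epimorphism.\<close>

lemma ex1_extension:
  assumes "f \<in> Arr C" "Dom C f = X" "Cod C f \<in> S"
  shows "\<exists>!g. g \<in> Hom C (onObj R X) (Cod C f) \<and> g \<cdot> r X = f"
proof -
  have X: "X \<in> Obj C" using assms by auto
  have f: "f \<in> Hom C X (onObj (id_functor (full_subcategory C S)) (Cod C f))"
    using assms by (simp add: Hom_def)
  obtain g where g: "g \<in> Hom (full_subcategory C S) (onObj R X) (Cod C f)"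
    and e: "f = onArr (id_functor (full_subcategory C S)) g \<cdot> r X"
    using f bij_betw_imp_surj_on[OF unit_universal[OF X assms(3)]] by blast
  have g: "g \<in> Hom C (onObj R X) (Cod C f) \<and> g \<cdot> r X = f"
  proof
    show "g \<in> Hom C (onObj R X) (Cod C f)"
      using g by (simp add: Hom_def)
    have "onArr (id_functor (full_subcategory C S)) g = g"
      using X g assms(3) by (simp add: Hom_def)
    then show "g \<cdot> r X = f" using e by simp
  qed
  then show ?thesis
  proof (rule ex1I)
    show "h = g" if "h \<in> Hom C (onObj R X) (Cod C f) \<and> h \<cdot> r X = f" for h
      using that g by (intro cancel_r[OF _ X, of h g]) (simp_all add: Hom_def)
  qed
qed

end


section \<open>The composite monad\<close>

locale lifted_epireflection = epireflection C S R r + monad_on C T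
  for C :: "('o, 'a) cat" (structure) and S R r and T :: "('o, 'a) mnd" +
  fixes L :: "('o \<times> 'a, ('o, 'a) alg_arr) mnd"
  assumes T_epi: "preserves_epis C C (Endo T)"
    and lifting: "lifting C T (reflector_monad C R r) L"
begin

abbreviation "To \<equiv> onObj (Endo T)"
abbreviation "Ta \<equiv> onArr (Endo T)"
abbreviation "Ro \<equiv> onObj R"
abbreviation "Ra \<equiv> onArr R"
abbreviation "\<mu> \<equiv> Mult T"
abbreviation "\<eta> \<equiv> Unit T"
abbreviation "m \<equiv> lifted_structure T L"

text \<open>For arrows out of \<open>T R X\<close>, such as algebra structures on \<open>R X\<close>, the epimorphism
  \<open>T r\<close> plays the part that \<open>r\<close> plays for arrows out of \<open>R X\<close>.\<close>

lemma cancel_T_r: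
  assumes "g \<cdot> Ta (r X) = h \<cdot> Ta (r X)" "X \<in> Obj C" "g \<in> Arr C" "h \<in> Arr C"
    "Dom C g = To (Ro X)" "Dom C h = To (Ro X)" "Cod C g = Cod C h"
  shows "g = h"
proof (rule epi_cancel)
  show "epi C (Ta (r X))"
    using T_epi epi_r[OF \<open>X \<in> Obj C\<close>] by (simp add: preserves_epis_def)
qed (use assms in simp_all)

text \<open>The lifted monad sends the free algebra to an algebra carried by its reflection. Its
  unit there is a homomorphism whose underlying arrow is \<open>r\<close>, and the second equation
  is the homomorphism law.\<close>

lemma
  assumes X: "X \<in> Obj C"
  shows algebra_m: "algebra C T (Ro (To X), m X)"
    and m_T_r: "m X \<cdot> Ta (r (To X)) = r (To X) \<cdot> \<mu> X"
proof -
  \<comment> \<open>the free algebra on \<open>X\<close>\<close>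
  let ?A = "(To X, \<mu> X)" and ?K = "algebras C T"
  have A: "?A \<in> Obj ?K"
    using algebra_free[OF X] by (simp add: algebras_def)
  have L: "monad ?K L"
    and ob: "comp_functor ?K (forgetful C T) (Endo L) = comp_functor ?K R (forgetful C T)"
    and un: "whiskerL ?K (forgetful C T) (Unit L) = whiskerR ?K r (forgetful C T)"
    using lifting by (simp_all add: lifting_def reflector_monad_def)
  interpret L: monad_on ?K L by unfold_locales (rule L)
  have LA: "onObj (Endo L) ?A \<in> Obj ?K"
    using A by (rule L.onObj_Obj)
  have "onObj (comp_functor ?K (forgetful C T) (Endo L)) ?A
      = onObj (comp_functor ?K R (forgetful C T)) ?A"
    by (simp only: ob)
  then have "fst (onObj (Endo L) ?A) = Ro (To X)"
    using A LA by (simp add: comp_functor_def compose_def forgetful_def)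
  then have LA_eq: "onObj (Endo L) ?A = (Ro (To X), m X)"
    by (simp add: lifted_structure_def prod_eq_iff)
  then show "algebra C T (Ro (To X), m X)"
    using LA by (simp add: algebras_def)
  have "whiskerL ?K (forgetful C T) (Unit L) ?A = whiskerR ?K r (forgetful C T) ?A"
    by (simp only: un)
  then have f: "fst (snd (Unit L ?A)) = r (To X)"
    using A L.unit.component_arrow[OF A] by (simp add: whiskerL_def whiskerR_def forgetful_def)
  have "Unit L ?A \<in> Arr ?K" "Dom ?K (Unit L ?A) = ?A"
    "Cod ?K (Unit L ?A) = (Ro (To X), m X)"
    using A L.unit.component_arrow[OF A] by (simp_all add: LA_eq)
  then have "algebra_hom C T ?A (r (To X)) (Ro (To X), m X)"
    using f by (auto simp: algebras_def)
  then show "m X \<cdot> Ta (r (To X)) = r (To X) \<cdot> \<mu> X"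
    by (simp add: algebra_hom_def)
qed

lemma m_arrow [simp]:
  assumes "X \<in> Obj C"
  shows "m X \<in> Arr C" "Dom C (m X) = To (Ro (To X))" "Cod C (m X) = Ro (To X)"
  using algebra_m[OF assms] by (simp_all add: algebra_def Hom_def)

lemma m_assoc: "X \<in> Obj C \<Longrightarrow> m X \<cdot> Ta (m X) = m X \<cdot> \<mu> (Ro (To X))"
  and m_unit: "X \<in> Obj C \<Longrightarrow> m X \<cdot> \<eta> (Ro (To X)) = Id C (Ro (To X))"
  using algebra_m[of X] by (simp_all add: algebra_def)

abbreviation "RT \<equiv> composite_monad C R r T L"
abbreviation "w \<equiv> Mult RT"

lemma Endo_RT [simp]: "Endo RT = comp_functor C R (Endo T)"
  by (simp add: composite_monad_def Let_def)

lemma Unit_RT [simp]: "X \<in> Obj C \<Longrightarrow> Unit RT X = r (To X) \<cdot> \<eta> X"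
  by (simp add: composite_monad_def Let_def vcomp_def whiskerR_def)

lemma RT_ext: "Unit RT \<in> extensional (Obj C)" "w \<in> extensional (Obj C)"
  by (simp_all add: composite_monad_def Let_def vcomp_def)

lemma
  assumes X: "X \<in> Obj C"
  shows w_Hom: "w X \<in> Hom C (Ro (To (Ro (To X)))) (Ro (To X))"
    and w_r: "w X \<cdot> r (To (Ro (To X))) = m X"
proof -
  have "w X = (THE w. w \<in> Hom C (Ro (To (Ro (To X)))) (Ro (To X)) \<and>
      w \<cdot> r (To (Ro (To X))) = m X)"
    using X by (simp add: composite_monad_def Let_def)
  moreover have "\<exists>!w. w \<in> Hom C (Ro (To (Ro (To X)))) (Ro (To X)) \<and>
      w \<cdot> r (To (Ro (To X))) = m X"
    using ex1_extension[of "m X" "To (Ro (To X))"] X by simp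
  ultimately show "w X \<in> Hom C (Ro (To (Ro (To X)))) (Ro (To X))"
    and "w X \<cdot> r (To (Ro (To X))) = m X"
    using theI'[of "\<lambda>w. w \<in> Hom C (Ro (To (Ro (To X)))) (Ro (To X)) \<and>
      w \<cdot> r (To (Ro (To X))) = m X"] by simp_all
qed

lemma w_arrow [simp]:
  assumes "X \<in> Obj C"
  shows "w X \<in> Arr C" "Dom C (w X) = Ro (To (Ro (To X)))" "Cod C (w X) = Ro (To X)"
  using w_Hom[OF assms] by (simp_all add: Hom_def)

text \<open>Rewriting with these moves a trailing \<open>r\<close> to the left past \<open>R f\<close> until it is
  absorbed by \<open>w\<close>, and a trailing \<open>T r\<close> into \<open>m\<close>.\<close>

lemmas r_rules = assoc_right onArr_Comp_arrow R_r precomposed[OF R_r] w_r precomposed[OF w_r]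
  m_T_r precomposed[OF m_T_r]

text \<open>After cancelling \<open>T r\<close> this is the naturality of \<open>\<mu>\<close>: the free algebra is functorial,
  and so is its reflection.\<close>

lemma m_natural:
  assumes "f \<in> Arr C" "Dom C f = X"
  shows "Ra (Ta f) \<cdot> m X = m (Cod C f) \<cdot> Ta (Ra (Ta f))"
proof (rule cancel_T_r[of _ "To X"])
  have "m (Cod C f) \<cdot> Ta (Ra (Ta f)) \<cdot> Ta (r (To X)) = m (Cod C f) \<cdot> Ta (Ra (Ta f) \<cdot> r (To X))"
    using assms by (auto simp: onArr_Comp_arrow)
  also have "\<dots> = r (To (Cod C f)) \<cdot> \<mu> (Cod C f) \<cdot> Ta (Ta f)"
    using assms by (auto simp: r_rules)
  also have "\<dots> = r (To (Cod C f)) \<cdot> Ta f \<cdot> \<mu> X"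
    using assms by (simp add: Mult_natural)
  finally show "(Ra (Ta f) \<cdot> m X) \<cdot> Ta (r (To X))
      = (m (Cod C f) \<cdot> Ta (Ra (Ta f))) \<cdot> Ta (r (To X))"
    using assms by (auto simp: r_rules)
qed (use assms in auto)

lemma w_natural:
  assumes "f \<in> Arr C" "Dom C f = X"
  shows "Ra (Ta f) \<cdot> w X = w (Cod C f) \<cdot> Ra (Ta (Ra (Ta f)))"
  by (rule cancel_r[of _ "To (Ro (To X))"]) (use assms in \<open>auto simp: r_rules m_natural\<close>)

lemma w_unit_left:
  assumes "X \<in> Obj C"
  shows "w X \<cdot> Ra (Ta (r (To X) \<cdot> \<eta> X)) = Id C (Ro (To X))"
  by (rule cancel_r[of _ "To X"]) (use assms in \<open>auto simp: r_rules Mult_Unit_left\<close>)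

lemma w_unit_right:
  assumes "X \<in> Obj C"
  shows "w X \<cdot> r (To (Ro (To X))) \<cdot> \<eta> (Ro (To X)) = Id C (Ro (To X))"
  using assms by (simp add: precomposed[OF w_r] m_unit)

text \<open>Cancelling \<open>r\<close> leaves \<open>m \<cdot> T w = w \<cdot> m\<close>. Cancelling \<open>T r\<close> in turn leaves the
  associativity of the algebra \<open>m\<close>.\<close>

lemma w_assoc:
  assumes X: "X \<in> Obj C"
  shows "w X \<cdot> Ra (Ta (w X)) = w X \<cdot> w (Ro (To X))"
proof (rule cancel_r[of _ "To (Ro (To (Ro (To X))))"])
  have "m X \<cdot> Ta (w X) = w X \<cdot> m (Ro (To X))"
  proof (rule cancel_T_r[of _ "To (Ro (To X))"])
    have "m X \<cdot> Ta (w X) \<cdot> Ta (r (To (Ro (To X)))) = m X \<cdot> Ta (m X)"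
      using X by (simp add: onArr_Comp_arrow[symmetric] w_r)
    also have "\<dots> = m X \<cdot> \<mu> (Ro (To X))"
      using X by (rule m_assoc)
    finally show "(m X \<cdot> Ta (w X)) \<cdot> Ta (r (To (Ro (To X))))
        = (w X \<cdot> m (Ro (To X))) \<cdot> Ta (r (To (Ro (To X))))"
      using X by (simp add: r_rules)
  qed (use X in auto)
  then show "(w X \<cdot> Ra (Ta (w X))) \<cdot> r (To (Ro (To (Ro (To X)))))
      = (w X \<cdot> w (Ro (To X))) \<cdot> r (To (Ro (To (Ro (To X)))))"
    using X by (simp add: r_rules)
qed (use X in auto)

theorem monad_composite: "monad C RT"
proof -
  interpret RT: is_functor C C "comp_functor C R (Endo T)"
    by (rule is_functor_comp_functor) unfold_locales
  interpret RTRT: is_functor C C "comp_functor C (comp_functor C R (Endo T)) (comp_functor C R (Endo T))"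
    by (rule is_functor_comp_functor) unfold_locales
  interpret I: is_functor C C "id_functor C"
    by (rule is_functor_id_functor) unfold_locales
  have "nat_trans C C (comp_functor C (Endo RT) (Endo RT)) (Endo RT) w"
    unfolding Endo_RT
    by unfold_locales (auto simp: Hom_def w_natural RT_ext)
  moreover have "nat_trans C C (id_functor C) (Endo RT) (Unit RT)"
    unfolding Endo_RT
    by unfold_locales
      (auto simp: Hom_def R_r precomposed[OF R_r] assoc_right Unit_natural RT_ext)
  ultimately show ?thesis
    unfolding monad_def
    by (auto simp: vcomp_def whiskerL_def whiskerR_def id_trans_def RT.is_functor_axioms
        w_assoc w_unit_left w_unit_right intro!: restrict_ext)
qed

end


section \<open>Extending a morphism of monads\<close>

locale morphism_to_reflective = lifted_epireflection C S R r T L + M: monad_on C M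
  for C :: "('o, 'a) cat" (structure) and S R r T L and M :: "('o, 'a) mnd" +
  fixes \<gamma> :: "'o \<Rightarrow> 'a"
  assumes \<gamma>: "monad_morphism C T M \<gamma>"
    and M_in_S: "X \<in> Obj C \<Longrightarrow> onObj (Endo M) X \<in> S"
begin

abbreviation "Mo \<equiv> onObj (Endo M)"
abbreviation "Ma \<equiv> onArr (Endo M)"

sublocale \<gamma>: nat_trans C C "Endo T" "Endo M" \<gamma>
  using \<gamma> by (simp add: monad_morphism_def)

lemma
  assumes X: "X \<in> Obj C"
  shows \<gamma>_unit: "\<gamma> X \<cdot> \<eta> X = Unit M X"
    and \<gamma>_mult: "\<gamma> X \<cdot> \<mu> X = Mult M X \<cdot> \<gamma> (Mo X) \<cdot> Ta (\<gamma> X)"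
proof -
  have "vcomp C C \<gamma> \<eta> X = Unit M X"
    "vcomp C C \<gamma> \<mu> X = vcomp C C (Mult M) (hcomp C C (Endo T) (Endo M) \<gamma> \<gamma>) X"
    using \<gamma> by (simp_all add: monad_morphism_def)
  then show "\<gamma> X \<cdot> \<eta> X = Unit M X" "\<gamma> X \<cdot> \<mu> X = Mult M X \<cdot> \<gamma> (Mo X) \<cdot> Ta (\<gamma> X)"
    using X by (simp_all add: vcomp_def hcomp_def whiskerL_def whiskerR_def)
qed

definition extend :: "'o \<Rightarrow> 'a" where
  "extend = (\<lambda>X\<in>Obj C. THE l. l \<in> Hom C (Ro (To X)) (Mo X) \<and> l \<cdot> r (To X) = \<gamma> X)"

lemma
  assumes X: "X \<in> Obj C"
  shows extend_Hom: "extend X \<in> Hom C (Ro (To X)) (Mo X)"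
    and extend_r: "extend X \<cdot> r (To X) = \<gamma> X"
proof -
  have "\<exists>!l. l \<in> Hom C (Ro (To X)) (Mo X) \<and> l \<cdot> r (To X) = \<gamma> X"
    using ex1_extension[of "\<gamma> X" "To X"] X M_in_S[OF X] by simp
  from theI'[OF this] show "extend X \<in> Hom C (Ro (To X)) (Mo X)"
    and "extend X \<cdot> r (To X) = \<gamma> X"
    using X by (simp_all add: extend_def)
qed

lemma extend_arrow [simp]:
  assumes "X \<in> Obj C"
  shows "extend X \<in> Arr C" "Dom C (extend X) = Ro (To X)" "Cod C (extend X) = Mo X"
  using extend_Hom[OF assms] by (simp_all add: Hom_def)

lemmas extend_rules = r_rules extend_r precomposed[OF extend_r]

lemma extend_natural:
  assumes "f \<in> Arr C" "Dom C f = X"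
  shows "Ma f \<cdot> extend X = extend (Cod C f) \<cdot> Ra (Ta f)"
  by (rule cancel_r[of _ "To X"])
    (use assms in \<open>auto simp: extend_rules \<gamma>.naturality_arrow\<close>)

lemma extend_unit:
  assumes "X \<in> Obj C"
  shows "extend X \<cdot> r (To X) \<cdot> \<eta> X = Unit M X"
  using assms by (simp add: extend_rules \<gamma>_unit)

text \<open>Cancelling \<open>r\<close> leaves \<open>\<lambda> \<cdot> m = n \<cdot> \<gamma>M \<cdot> T\<lambda>\<close>, with \<open>\<lambda>\<close> the extension and \<open>n\<close>
  the multiplication of \<open>M\<close>. Cancelling \<open>T r\<close> in turn leaves the compatibility of \<open>\<gamma>\<close>
  with the multiplications.\<close>

lemma extend_mult:
  assumes X: "X \<in> Obj C"
  shows "extend X \<cdot> w X = Mult M X \<cdot> extend (Mo X) \<cdot> Ra (Ta (extend X))"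
proof (rule cancel_r[of _ "To (Ro (To X))"])
  have "extend X \<cdot> m X = Mult M X \<cdot> \<gamma> (Mo X) \<cdot> Ta (extend X)"
  proof (rule cancel_T_r[of _ "To X"])
    have "(Mult M X \<cdot> \<gamma> (Mo X) \<cdot> Ta (extend X)) \<cdot> Ta (r (To X))
        = Mult M X \<cdot> \<gamma> (Mo X) \<cdot> Ta (\<gamma> X)"
      using X by (simp add: assoc_right onArr_Comp_arrow[symmetric] extend_r)
    also have "\<dots> = \<gamma> X \<cdot> \<mu> X"
      using X by (simp add: \<gamma>_mult)
    finally show "(extend X \<cdot> m X) \<cdot> Ta (r (To X))
        = (Mult M X \<cdot> \<gamma> (Mo X) \<cdot> Ta (extend X)) \<cdot> Ta (r (To X))"
      using X by (simp add: extend_rules)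
  qed (use X in auto)
  then show "(extend X \<cdot> w X) \<cdot> r (To (Ro (To X)))
      = (Mult M X \<cdot> extend (Mo X) \<cdot> Ra (Ta (extend X))) \<cdot> r (To (Ro (To X)))"
    using X by (simp add: extend_rules)
qed (use X in auto)

lemma monad_morphism_extend: "monad_morphism C RT M extend"
proof -
  interpret RT: is_functor C C "comp_functor C R (Endo T)"
    by (rule is_functor_comp_functor) unfold_locales
  have "nat_trans C C (Endo RT) (Endo M) extend"
    unfolding Endo_RT
    by unfold_locales (auto simp: Hom_def extend_natural, simp add: extend_def)
  moreover have "vcomp C C extend (Unit RT) = Unit M"
    by (rule extensionalityI[of _ "Obj C"])
      (simp_all add: vcomp_def extend_unit M.unit.component_ext)
  moreover have "vcomp C C extend w = vcomp C C (Mult M) (hcomp C C (Endo RT) (Endo M) extend extend)"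
    by (auto simp: vcomp_def hcomp_def whiskerL_def whiskerR_def extend_mult intro!: restrict_ext)
  ultimately show ?thesis
    using monad_composite M.monad by (simp add: monad_morphism_def)
qed

lemma vcomp_extend: "vcomp C C extend (whiskerR C r (Endo T)) = \<gamma>"
  by (rule extensionalityI[of _ "Obj C"])
    (simp_all add: vcomp_def whiskerR_def extend_r \<gamma>.component_ext)

lemma extend_unique:
  assumes "nat_trans C C (Endo RT) (Endo M) l"
    and l: "vcomp C C l (whiskerR C r (Endo T)) = \<gamma>"
  shows "l = extend"
proof (rule extensionalityI[of _ "Obj C"])
  interpret l: nat_trans C C "comp_functor C R (Endo T)" "Endo M" l
    using assms(1) by simp
  show "l \<in> extensional (Obj C)" by (rule l.component_ext)
  show "extend \<in> extensional (Obj C)" by (simp add: extend_def)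
  show "l X = extend X" if X: "X \<in> Obj C" for X
  proof (rule cancel_r[of _ "To X"])
    have "vcomp C C l (whiskerR C r (Endo T)) X = \<gamma> X" by (simp only: l)
    then show "l X \<cdot> r (To X) = extend X \<cdot> r (To X)"
      using X by (simp add: vcomp_def whiskerR_def extend_r)
  qed (use X in auto)
qed

end

theorem theorem27:
  fixes C :: "('o, 'a) cat"
    and S :: "'o set"
    and R :: "('o, 'a, 'o, 'a) func"
    and r :: "'o \<Rightarrow> 'a"
    and T M :: "('o, 'a) mnd"
    and L :: "('o \<times> 'a, ('o, 'a) alg_arr) mnd"
    and \<gamma> :: "'o \<Rightarrow> 'a"
  assumes "category C"
    and "epireflector C S R r"
    and "monad C T"
    and "monad C M"
    and "preserves_epis C C (Endo T)"
    and "lifting C T (reflector_monad C R r) L"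
    and "\<forall>X \<in> Obj C. onObj (Endo M) X \<in> Obj (full_subcategory C S)"
    and "monad_morphism C T M \<gamma>"
  shows "\<exists>!l. monad_morphism C (composite_monad C R r T L) M l \<and>
    vcomp C C l (whiskerR C r (Endo T)) = \<gamma>"
proof -
  interpret morphism_to_reflective C S R r T L M \<gamma>
    using assms
    by (auto simp: morphism_to_reflective_def lifted_epireflection_def epireflection_def
        monad_on_def epireflection_axioms_def lifted_epireflection_axioms_def
        morphism_to_reflective_axioms_def full_subcategory_def)
  show ?thesis
  proof (rule ex1I)
    show "monad_morphism C (composite_monad C R r T L) M extend \<and>
        vcomp C C extend (whiskerR C r (Endo T)) = \<gamma>"
      by (simp add: monad_morphism_extend vcomp_extend del: Endo_RT)
    show "l = extend" if "monad_morphism C (composite_monad C R r T L) M l \<and>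
        vcomp C C l (whiskerR C r (Endo T)) = \<gamma>" for l
      using that by (intro extend_unique) (auto simp: monad_morphism_def)
  qed
qed

end
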